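(* Let $F\in\mathcal{C}_{+1}$ be a functor with a minimal presentation $(X\xrightarrow{f}Y)$. If some irreducible representation of $\mathrm{Aut}_{\mathcal{C}_{+1}}(F)$ is the functor morphing of an irreducible representation of $\mathrm{Aut}_R(M)$, then $X$ is (isomorphic to) a direct summand of $M$.
   Context: $R$ is a finite ring, $M$ is a finite $R$-module, and $M=M_1^{a_1}\oplus\cdots\oplus M_n^{a_n}$ is its decomposition with $M_1,\dots,M_n$ pairwise non-isomorphic indecomposable modules. $\mathcal{C}=\langle M_1,\ldots,M_n\rangle$ is the full subcategory of $R$-modules of the form $\bigoplus_i M_i^{b_i}$, $b_i\ge 0$. $\mathcal{C}_{+1}$ is the abelian category of additive functors from $\mathcal{C}$ to finite abelian groups, with natural transformations as morphisms (kernels, images, direct sums are computed objectwise). A presentation $(X\xrightarrow{f}Y)$ of $F\in\mathcal{C}_{+1}$ is a morphism $f:X\to Y$ in $\mathcal{C}$ with an exact sequence $\mathrm{Hom}_R(Y,-)\xrightarrow{f^*}\mathrm{Hom}_R(X,-)\to F\to 0$ in $\mathcal{C}_{+1}$; it is minimal if this is (the beginning of) a minimal projective resolution of $F$. Functor morphing: let $K=\mathbb{C}$; all representations are finite-dimensional over $K$. For $F\in\mathcal{C}_{+1}$, $KF(M)$ is the vector space with basis $\{u_v\}_{v\in F(M)}$, with commuting actions of $\mathrm{Aut}_R(M)$ by $g\cdot u_v=u_{F(g)(v)}$ and of $\mathrm{Aut}_{\mathcal{C}_{+1}}(F)$ by $\alpha\cdot u_v=u_{\alpha_M(v)}$. Write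 $G\prec F$ if $G$ is isomorphic to a subquotient of $F$ and $G\not\cong F$. It is known that for every irreducible representation $V$ of $\mathrm{Aut}_R(M)$ there is a unique up to isomorphism $F\in\mathcal{C}_{+1}$ with $\mathrm{Hom}_{\mathrm{Aut}_R(M)}(KF(M),V)\ne 0$ and $\mathrm{Hom}_{\mathrm{Aut}_R(M)}(KG(M),V)=0$ for all $G\prec F$, and that for this $F$ the space $\widetilde V=\mathrm{Hom}_{\mathrm{Aut}_R(M)}(KF(M),V)$, with $\mathrm{Aut}_{\mathcal{C}_{+1}}(F)$ acting by $\alpha\cdot T=T\circ\alpha^{-1}$, is an irreducible representation of $\mathrm{Aut}_{\mathcal{C}_{+1}}(F)$. The pair $(F,\widetilde V)$ is called the functor morphing of $V$; one also says that the representation $\widetilde V$ of $\mathrm{Aut}_{\mathcal{C}_{+1}}(F)$ is the functor morphing of $V$. *)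

theory Defs
  imports "HOL-Algebra.Module" "HOL-Algebra.AbelCoset" "HOL-Library.Function_Algebras" "HOL-Library.Infinite_Typeclass"
    Complex_Main
begin

section \<open>Modules over a ring that need not be commutative\<close>

text \<open>The library locale \<open>module\<close> assumes a commutative ring of scalars.  As there, the
  multiplicative fields \<open>mult\<close> and \<open>one\<close> of the record \<open>module\<close> are irrelevant.\<close>

locale left_module = R?: ring R + M?: abelian_group M
  for R :: "'r ring" (structure) and M :: "('r, 'a) module" (structure) +
  assumes smult_closed: "\<lbrakk>r \<in> carrier R; x \<in> carrier M\<rbrakk> \<Longrightarrow> r \<odot>\<^bsub>M\<^esub> x \<in> carrier M"
    and smult_l_distr: "\<lbrakk>r \<in> carrier R; s \<in> carrier R; x \<in> carrier M\<rbrakk> \<Longrightarrow>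
      (r \<oplus>\<^bsub>R\<^esub> s) \<odot>\<^bsub>M\<^esub> x = r \<odot>\<^bsub>M\<^esub> x \<oplus>\<^bsub>M\<^esub> s \<odot>\<^bsub>M\<^esub> x"
    and smult_r_distr: "\<lbrakk>r \<in> carrier R; x \<in> carrier M; y \<in> carrier M\<rbrakk> \<Longrightarrow>
      r \<odot>\<^bsub>M\<^esub> (x \<oplus>\<^bsub>M\<^esub> y) = r \<odot>\<^bsub>M\<^esub> x \<oplus>\<^bsub>M\<^esub> r \<odot>\<^bsub>M\<^esub> y"
    and smult_assoc: "\<lbrakk>r \<in> carrier R; s \<in> carrier R; x \<in> carrier M\<rbrakk> \<Longrightarrow>
      (r \<otimes>\<^bsub>R\<^esub> s) \<odot>\<^bsub>M\<^esub> x = r \<odot>\<^bsub>M\<^esub> (s \<odot>\<^bsub>M\<^esub> x)"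
    and smult_one: "x \<in> carrier M \<Longrightarrow> \<one>\<^bsub>R\<^esub> \<odot>\<^bsub>M\<^esub> x = x"

text \<open>Homomorphisms are extensional functions, so that equality of homomorphisms is equality in
  HOL; accordingly they are composed with \<open>compose (carrier _)\<close>.\<close>

definition mod_hom :: "'r ring \<Rightarrow> ('r, 'a) module \<Rightarrow> ('r, 'b) module \<Rightarrow> ('a \<Rightarrow> 'b) set" where
  "mod_hom R X Y = {h \<in> carrier X \<rightarrow>\<^sub>E carrier Y.
     (\<forall>x\<in>carrier X. \<forall>y\<in>carrier X. h (x \<oplus>\<^bsub>X\<^esub> y) = h x \<oplus>\<^bsub>Y\<^esub> h y) \<and>
     (\<forall>r\<in>carrier R. \<forall>x\<in>carrier X. h (r \<odot>\<^bsub>X\<^esub> x) = r \<odot>\<^bsub>Y\<^esub> h x)}"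

definition mod_iso :: "'r ring \<Rightarrow> ('r, 'a) module \<Rightarrow> ('r, 'b) module \<Rightarrow> bool" where
  "mod_iso R X Y \<longleftrightarrow> (\<exists>h \<in> mod_hom R X Y. bij_betw h (carrier X) (carrier Y))"

definition mod_id :: "('r, 'a) module \<Rightarrow> 'a \<Rightarrow> 'a" where
  "mod_id X = (\<lambda>x\<in>carrier X. x)"

definition internal_sum :: "'r ring \<Rightarrow> ('r, 'a) module \<Rightarrow> 'a set \<Rightarrow> 'a set \<Rightarrow> bool" where
  "internal_sum R M A B \<longleftrightarrow> submodule A R M \<and> submodule B R M \<and>
     A \<inter> B = {\<zero>\<^bsub>M\<^esub>} \<and> A <+>\<^bsub>M\<^esub> B = carrier M"

definition indecomposable :: "'r ring \<Rightarrow> ('r, 'a) module \<Rightarrow> bool" where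
  "indecomposable R M \<longleftrightarrow> carrier M \<noteq> {\<zero>\<^bsub>M\<^esub>} \<and>
     (\<forall>A B. internal_sum R M A B \<longrightarrow> A = {\<zero>\<^bsub>M\<^esub>} \<or> B = {\<zero>\<^bsub>M\<^esub>})"

definition iso_to_summand :: "'r ring \<Rightarrow> ('r, 'a) module \<Rightarrow> ('r, 'b) module \<Rightarrow> bool" where
  "iso_to_summand R X M \<longleftrightarrow>
     (\<exists>A B. internal_sum R M A B \<and> mod_iso R X (M\<lparr>carrier := A\<rparr>))"

text \<open>The external direct sum of \<open>b i\<close> copies of \<open>Ms i\<close>, for \<open>i < n\<close>.\<close>

definition power_sum ::
    "nat \<Rightarrow> (nat \<Rightarrow> ('r, 'a) module) \<Rightarrow> (nat \<Rightarrow> nat) \<Rightarrow> ('r, nat \<times> nat \<Rightarrow> 'a) module" where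
  "power_sum n Ms b = (let I = (SIGMA i:{..<n}. {..<b i}) in
     \<lparr>carrier = (\<Pi>\<^sub>E k\<in>I. carrier (Ms (fst k))),
      mult = undefined, one = undefined,
      zero = (\<lambda>k\<in>I. \<zero>\<^bsub>Ms (fst k)\<^esub>),
      add = (\<lambda>x y. \<lambda>k\<in>I. x k \<oplus>\<^bsub>Ms (fst k)\<^esub> y k),
      smult = (\<lambda>r x. \<lambda>k\<in>I. r \<odot>\<^bsub>Ms (fst k)\<^esub> x k)\<rparr>)"

definition aut_group :: "'r ring \<Rightarrow> ('r, 'a) module \<Rightarrow> ('a \<Rightarrow> 'a) monoid" where
  "aut_group R M =
     \<lparr>carrier = {h \<in> mod_hom R M M. bij_betw h (carrier M) (carrier M)},
      mult = (\<lambda>g h. compose (carrier M) g h),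
      one = mod_id M\<rparr>"

section \<open>The category \<open>\<C>\<close> and the functor category \<open>\<C>\<^sub>+\<^sub>1\<close>\<close>

text \<open>The objects of \<open>\<langle>Ms 0, \<dots>, Ms (n - 1)\<rangle>\<close>: all modules with carrier in the universe \<open>'u\<close>
  that are isomorphic to one of the sums.  When \<open>'u\<close> is infinite, every finite module has an
  isomorphic copy there.  The morphisms are those of \<^const>\<open>mod_hom\<close>, the subcategory being full.\<close>

definition sum_cat ::
    "'r ring \<Rightarrow> nat \<Rightarrow> (nat \<Rightarrow> ('r, 'u) module) \<Rightarrow> ('r, 'u) module set" where
  "sum_cat R n Ms = {X. left_module R X \<and> (\<exists>b. mod_iso R X (power_sum n Ms b))}"

text \<open>Abelian groups are written multiplicatively, as library structures \<^locale>\<open>comm_group\<close>.\<close>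

record ('r, 'u, 'g) modfunctor =
  fobj :: "('r, 'u) module \<Rightarrow> 'g monoid"
  fmap :: "('r, 'u) module \<Rightarrow> ('r, 'u) module \<Rightarrow> ('u \<Rightarrow> 'u) \<Rightarrow> 'g \<Rightarrow> 'g"

definition hom_add :: "('r, 'a) module \<Rightarrow> ('r, 'b) module \<Rightarrow> ('a \<Rightarrow> 'b) \<Rightarrow> ('a \<Rightarrow> 'b) \<Rightarrow> 'a \<Rightarrow> 'b" where
  "hom_add X Y h k = (\<lambda>x\<in>carrier X. h x \<oplus>\<^bsub>Y\<^esub> k x)"

text \<open>The objects of \<open>\<C>\<^sub>+\<^sub>1\<close>.\<close>

definition additive_functor ::
    "'r ring \<Rightarrow> ('r, 'u) module set \<Rightarrow> ('r, 'u, 'g) modfunctor \<Rightarrow> bool" where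
  "additive_functor R C F \<longleftrightarrow>
     (\<forall>X\<in>C. comm_group (fobj F X) \<and> finite (carrier (fobj F X))) \<and>
     (\<forall>X\<in>C. \<forall>Y\<in>C. \<forall>h\<in>mod_hom R X Y. fmap F X Y h \<in> hom (fobj F X) (fobj F Y)) \<and>
     (\<forall>X\<in>C. \<forall>v\<in>carrier (fobj F X). fmap F X X (mod_id X) v = v) \<and>
     (\<forall>X\<in>C. \<forall>Y\<in>C. \<forall>Z\<in>C. \<forall>h\<in>mod_hom R X Y. \<forall>k\<in>mod_hom R Y Z. \<forall>v\<in>carrier (fobj F X).
        fmap F X Z (compose (carrier X) k h) v = fmap F Y Z k (fmap F X Y h v)) \<and>
     (\<forall>X\<in>C. \<forall>Y\<in>C. \<forall>h\<in>mod_hom R X Y. \<forall>k\<in>mod_hom R X Y. \<forall>v\<in>carrier (fobj F X).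
        fmap F X Y (hom_add X Y h k) v = fmap F X Y h v \<otimes>\<^bsub>fobj F Y\<^esub> fmap F X Y k v)"

text \<open>Natural transformations are extensional, in the object and in the element, so that
  equality is equality in HOL.\<close>

definition nat_trans ::
    "'r ring \<Rightarrow> ('r, 'u) module set \<Rightarrow> ('r, 'u, 'g) modfunctor \<Rightarrow> ('r, 'u, 'h) modfunctor \<Rightarrow>
     (('r, 'u) module \<Rightarrow> 'g \<Rightarrow> 'h) set" where
  "nat_trans R C F G = {\<alpha> \<in> extensional C.
     (\<forall>X\<in>C. \<alpha> X \<in> extensional (carrier (fobj F X)) \<and> \<alpha> X \<in> hom (fobj F X) (fobj G X)) \<and>
     (\<forall>X\<in>C. \<forall>Y\<in>C. \<forall>h\<in>mod_hom R X Y. \<forall>v\<in>carrier (fobj F X).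
        \<alpha> Y (fmap F X Y h v) = fmap G X Y h (\<alpha> X v))}"

definition nat_epi ::
    "('r, 'u) module set \<Rightarrow> ('r, 'u, 'g) modfunctor \<Rightarrow> ('r, 'u, 'h) modfunctor \<Rightarrow>
     (('r, 'u) module \<Rightarrow> 'g \<Rightarrow> 'h) \<Rightarrow> bool" where
  "nat_epi C F G \<alpha> \<longleftrightarrow> (\<forall>X\<in>C. \<alpha> X ` carrier (fobj F X) = carrier (fobj G X))"

definition functor_iso ::
    "'r ring \<Rightarrow> ('r, 'u) module set \<Rightarrow> ('r, 'u, 'g) modfunctor \<Rightarrow> ('r, 'u, 'h) modfunctor \<Rightarrow> bool" where
  "functor_iso R C F G \<longleftrightarrow> (\<exists>\<alpha> \<in> nat_trans R C F G.
     \<forall>X\<in>C. bij_betw (\<alpha> X) (carrier (fobj F X)) (carrier (fobj G X)))"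

definition functor_aut_group ::
    "'r ring \<Rightarrow> ('r, 'u) module set \<Rightarrow> ('r, 'u, 'g) modfunctor \<Rightarrow>
     (('r, 'u) module \<Rightarrow> 'g \<Rightarrow> 'g) monoid" where
  "functor_aut_group R C F =
     \<lparr>carrier = {\<alpha> \<in> nat_trans R C F F.
        \<forall>X\<in>C. bij_betw (\<alpha> X) (carrier (fobj F X)) (carrier (fobj F X))},
      mult = (\<lambda>\<alpha> \<beta>. \<lambda>X\<in>C. compose (carrier (fobj F X)) (\<alpha> X) (\<beta> X)),
      one = (\<lambda>X\<in>C. \<lambda>v\<in>carrier (fobj F X). v)\<rparr>"

definition subfunctor ::
    "'r ring \<Rightarrow> ('r, 'u) module set \<Rightarrow> (('r, 'u) module \<Rightarrow> 'g set) \<Rightarrow>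
     ('r, 'u, 'g) modfunctor \<Rightarrow> bool" where
  "subfunctor R C K F \<longleftrightarrow> (\<forall>X\<in>C. subgroup (K X) (fobj F X)) \<and>
     (\<forall>X\<in>C. \<forall>Y\<in>C. \<forall>h\<in>mod_hom R X Y. fmap F X Y h ` K X \<subseteq> K Y)"

definition restrict_functor ::
    "('r, 'u, 'g) modfunctor \<Rightarrow> (('r, 'u) module \<Rightarrow> 'g set) \<Rightarrow> ('r, 'u, 'g) modfunctor" where
  "restrict_functor F K = F\<lparr>fobj := \<lambda>X. (fobj F X)\<lparr>carrier := K X\<rparr>\<rparr>"

text \<open>The subquotient \<open>B/A\<close>.  A coset \<open>S\<close> of \<open>A X\<close> is sent to \<open>A Y \<cdot> F(h)(S)\<close>, which is the
  coset of \<open>A Y\<close> containing \<open>F(h)(S)\<close>.\<close>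

definition subquotient ::
    "('r, 'u, 'g) modfunctor \<Rightarrow> (('r, 'u) module \<Rightarrow> 'g set) \<Rightarrow> (('r, 'u) module \<Rightarrow> 'g set) \<Rightarrow>
     ('r, 'u, 'g set) modfunctor" where
  "subquotient F B A =
     \<lparr>fobj = (\<lambda>X. (fobj F X)\<lparr>carrier := B X\<rparr> Mod A X),
      fmap = (\<lambda>X Y h S. A Y <#>\<^bsub>fobj F Y\<^esub> (fmap F X Y h ` S))\<rparr>"

definition strictly_below ::
    "'r ring \<Rightarrow> ('r, 'u) module set \<Rightarrow> ('r, 'u, 'h) modfunctor \<Rightarrow> ('r, 'u, 'g) modfunctor \<Rightarrow> bool" where
  "strictly_below R C G F \<longleftrightarrow>
     (\<exists>B A. subfunctor R C B F \<and> subfunctor R C A F \<and> (\<forall>X\<in>C. A X \<subseteq> B X) \<and>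
        functor_iso R C G (subquotient F B A)) \<and>
     \<not> functor_iso R C G F"

section \<open>Minimal presentations\<close>

definition hom_functor :: "'r ring \<Rightarrow> ('r, 'u) module \<Rightarrow> ('r, 'u, 'u \<Rightarrow> 'u) modfunctor" where
  "hom_functor R X =
     \<lparr>fobj = (\<lambda>N. \<lparr>carrier = mod_hom R X N, mult = hom_add X N, one = (\<lambda>x\<in>carrier X. \<zero>\<^bsub>N\<^esub>)\<rparr>),
      fmap = (\<lambda>N N' k h. compose (carrier X) k h)\<rparr>"

text \<open>\<open>f\<^sup>* : Hom\<^sub>R(Y, -) \<rightarrow> Hom\<^sub>R(X, -)\<close> for \<open>f : X \<rightarrow> Y\<close>.\<close>

definition precomp ::
    "'r ring \<Rightarrow> ('r, 'u) module set \<Rightarrow> ('r, 'u) module \<Rightarrow> ('r, 'u) module \<Rightarrow> ('u \<Rightarrow> 'u) \<Rightarrow>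
     ('r, 'u) module \<Rightarrow> ('u \<Rightarrow> 'u) \<Rightarrow> 'u \<Rightarrow> 'u" where
  "precomp R C X Y f = (\<lambda>N\<in>C. \<lambda>h\<in>mod_hom R Y N. compose (carrier X) h f)"

definition nat_kernel ::
    "('r, 'u, 'g) modfunctor \<Rightarrow> ('r, 'u, 'h) modfunctor \<Rightarrow> (('r, 'u) module \<Rightarrow> 'g \<Rightarrow> 'h) \<Rightarrow>
     ('r, 'u) module \<Rightarrow> 'g set" where
  "nat_kernel F G \<alpha> = (\<lambda>X. kernel (fobj F X) (fobj G X) (\<alpha> X))"

text \<open>The lifting property is tested against functors with values in the universe \<open>'h\<close>; for
  infinite \<open>'h\<close> these are all functors up to isomorphism.\<close>

definition projective ::
    "'h itself \<Rightarrow> 'r ring \<Rightarrow> ('r, 'u) module set \<Rightarrow> ('r, 'u, 'g) modfunctor \<Rightarrow> bool" where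
  "projective (_ :: 'h itself) R C P \<longleftrightarrow> additive_functor R C P \<and>
     (\<forall>(G :: ('r, 'u, 'h) modfunctor) (H :: ('r, 'u, 'h) modfunctor) e t.
        additive_functor R C G \<and> additive_functor R C H \<and>
        e \<in> nat_trans R C G H \<and> nat_epi C G H e \<and> t \<in> nat_trans R C P H \<longrightarrow>
        (\<exists>s \<in> nat_trans R C P G. \<forall>N\<in>C. \<forall>x\<in>carrier (fobj P N). e N (s N x) = t N x))"

definition superfluous ::
    "'r ring \<Rightarrow> ('r, 'u) module set \<Rightarrow> (('r, 'u) module \<Rightarrow> 'g set) \<Rightarrow>
     ('r, 'u, 'g) modfunctor \<Rightarrow> bool" where
  "superfluous R C K P \<longleftrightarrow>
     (\<forall>L. subfunctor R C L P \<and> (\<forall>N\<in>C. L N <#>\<^bsub>fobj P N\<^esub> K N = carrier (fobj P N)) \<longrightarrow>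
        (\<forall>N\<in>C. L N = carrier (fobj P N)))"

definition projective_cover ::
    "'r ring \<Rightarrow> ('r, 'u) module set \<Rightarrow> ('r, 'u, 'g) modfunctor \<Rightarrow> ('r, 'u, 'h) modfunctor \<Rightarrow>
     (('r, 'u) module \<Rightarrow> 'g \<Rightarrow> 'h) \<Rightarrow> bool" where
  "projective_cover R C P F p \<longleftrightarrow> projective TYPE('h) R C P \<and>
     p \<in> nat_trans R C P F \<and> nat_epi C P F p \<and> superfluous R C (nat_kernel P F p) P"

text \<open>The beginning \<open>P\<^sub>1 \<rightarrow> P\<^sub>0 \<rightarrow> F \<rightarrow> 0\<close> of a minimal projective resolution: \<open>P\<^sub>0\<close> is a projective
  cover of \<open>F\<close>, and \<open>P\<^sub>1\<close> one of the kernel of \<open>P\<^sub>0 \<rightarrow> F\<close>; the latter includes exactness at \<open>P\<^sub>0\<close>.\<close>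

definition minimal_presentation ::
    "'r ring \<Rightarrow> ('r, 'u) module set \<Rightarrow> ('r, 'u) module \<Rightarrow> ('u \<Rightarrow> 'u) \<Rightarrow> ('r, 'u) module \<Rightarrow>
     ('r, 'u, 'g) modfunctor \<Rightarrow> bool" where
  "minimal_presentation R C X f Y F \<longleftrightarrow> X \<in> C \<and> Y \<in> C \<and> f \<in> mod_hom R X Y \<and>
     (\<exists>p. projective_cover R C (hom_functor R X) F p \<and>
        projective_cover R C (hom_functor R Y)
          (restrict_functor (hom_functor R X) (nat_kernel (hom_functor R X) F p))
          (precomp R C X Y f))"

section \<open>Finite-dimensional complex representations\<close>

text \<open>The underlying space is the subspace \<open>rspace V\<close> of \<open>'v\<close>.\<close>

record ('a, 'v) group_rep =
  rspace :: "'v set"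
  ract :: "'a \<Rightarrow> 'v \<Rightarrow> 'v"
  rscale :: "complex \<Rightarrow> 'v \<Rightarrow> 'v"

definition representation_of :: "'a monoid \<Rightarrow> ('a, 'v::ab_group_add) group_rep \<Rightarrow> bool" where
  "representation_of G V \<longleftrightarrow> group G \<and> vector_space (rscale V) \<and>
     module.subspace (rscale V) (rspace V) \<and>
     (\<exists>B. finite B \<and> rspace V = module.span (rscale V) B) \<and>
     (\<forall>g\<in>carrier G. \<forall>x\<in>rspace V. ract V g x \<in> rspace V) \<and>
     (\<forall>g\<in>carrier G. \<forall>x\<in>rspace V. \<forall>y\<in>rspace V. ract V g (x + y) = ract V g x + ract V g y) \<and>
     (\<forall>g\<in>carrier G. \<forall>c. \<forall>x\<in>rspace V. ract V g (rscale V c x) = rscale V c (ract V g x)) \<and>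
     (\<forall>x\<in>rspace V. ract V \<one>\<^bsub>G\<^esub> x = x) \<and>
     (\<forall>g\<in>carrier G. \<forall>h\<in>carrier G. \<forall>x\<in>rspace V. ract V (g \<otimes>\<^bsub>G\<^esub> h) x = ract V g (ract V h x))"

definition irreducible_rep :: "'a monoid \<Rightarrow> ('a, 'v::ab_group_add) group_rep \<Rightarrow> bool" where
  "irreducible_rep G V \<longleftrightarrow> representation_of G V \<and> rspace V \<noteq> {0} \<and>
     (\<forall>U. module.subspace (rscale V) U \<and> U \<subseteq> rspace V \<and> (\<forall>g\<in>carrier G. ract V g ` U \<subseteq> U) \<longrightarrow>
        U = {0} \<or> U = rspace V)"

text \<open>\<open>Hom\<^sub>G(V, W)\<close>.  Its elements are \<open>0\<close> outside \<open>rspace V\<close>, which makes it a subspace of the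
  space of all functions.\<close>

definition intertwiners ::
    "'a monoid \<Rightarrow> ('a, 'v::ab_group_add) group_rep \<Rightarrow> ('a, 'w::ab_group_add) group_rep \<Rightarrow>
     ('v \<Rightarrow> 'w) set" where
  "intertwiners G V W = {T. (\<forall>x. x \<notin> rspace V \<longrightarrow> T x = 0) \<and> T ` rspace V \<subseteq> rspace W \<and>
     (\<forall>x\<in>rspace V. \<forall>y\<in>rspace V. T (x + y) = T x + T y) \<and>
     (\<forall>c. \<forall>x\<in>rspace V. T (rscale V c x) = rscale W c (T x)) \<and>
     (\<forall>g\<in>carrier G. \<forall>x\<in>rspace V. T (ract V g x) = ract W g (T x))}"

definition rep_iso ::
    "'a monoid \<Rightarrow> ('a, 'v::ab_group_add) group_rep \<Rightarrow> ('a, 'w::ab_group_add) group_rep \<Rightarrow> bool" where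
  "rep_iso G V W \<longleftrightarrow> (\<exists>T \<in> intertwiners G V W. bij_betw T (rspace V) (rspace W))"

text \<open>The vector space with basis \<open>u\<^sub>v\<close>, \<open>v \<in> S\<close>, consists of the functions vanishing outside \<open>S\<close>,
  with \<open>u\<^sub>v\<close> the indicator function of \<open>v\<close>; \<open>a\<close> acts by the linear extension of
  \<open>u\<^sub>v \<mapsto> u\<^bsub>p a v\<^esub>\<close>.\<close>

definition basis_vec :: "'g \<Rightarrow> 'g \<Rightarrow> complex" where
  "basis_vec v = (\<lambda>x. if x = v then 1 else 0)"

definition perm_rep :: "'g set \<Rightarrow> ('a \<Rightarrow> 'g \<Rightarrow> 'g) \<Rightarrow> ('a, 'g \<Rightarrow> complex) group_rep" where
  "perm_rep S p =
     \<lparr>rspace = {\<phi>. \<forall>x. x \<notin> S \<longrightarrow> \<phi> x = 0},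
      ract = (\<lambda>a \<phi> x. \<Sum>v\<in>S. \<phi> v * basis_vec (p a v) x),
      rscale = (\<lambda>c \<phi> x. c * \<phi> x)\<rparr>"

section \<open>Functor morphing\<close>

text \<open>\<open>KF(M)\<close> as a representation of \<open>Aut\<^sub>R(M)\<close> and as a representation of \<open>Aut(F)\<close>.\<close>

definition KF_mod ::
    "('r, 'u, 'g) modfunctor \<Rightarrow> ('r, 'u) module \<Rightarrow> ('u \<Rightarrow> 'u, 'g \<Rightarrow> complex) group_rep" where
  "KF_mod F M = perm_rep (carrier (fobj F M)) (\<lambda>g. fmap F M M g)"

definition KF_fun ::
    "('r, 'u, 'g) modfunctor \<Rightarrow> ('r, 'u) module \<Rightarrow>
     (('r, 'u) module \<Rightarrow> 'g \<Rightarrow> 'g, 'g \<Rightarrow> complex) group_rep" where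
  "KF_fun F M = perm_rep (carrier (fobj F M)) (\<lambda>\<alpha>. \<alpha> M)"

text \<open>\<open>Hom(KF(M), V)\<close> over \<open>Aut\<^sub>R(M)\<close>, on which \<open>Aut(F)\<close> acts by \<open>\<alpha> \<cdot> T = T \<circ> \<alpha>\<inverse>\<close>.\<close>

definition morphing_rep ::
    "'r ring \<Rightarrow> ('r, 'u) module set \<Rightarrow> ('r, 'u) module \<Rightarrow> ('r, 'u, 'g) modfunctor \<Rightarrow>
     ('u \<Rightarrow> 'u, 'v::ab_group_add) group_rep \<Rightarrow>
     (('r, 'u) module \<Rightarrow> 'g \<Rightarrow> 'g, ('g \<Rightarrow> complex) \<Rightarrow> 'v) group_rep" where
  "morphing_rep R C M F V =
     \<lparr>rspace = intertwiners (aut_group R M) (KF_mod F M) V,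
      ract = (\<lambda>\<alpha> T \<phi>. if \<phi> \<in> rspace (KF_fun F M)
                then T (ract (KF_fun F M) (inv\<^bsub>functor_aut_group R C F\<^esub> \<alpha>) \<phi>) else 0),
      rscale = (\<lambda>c T \<phi>. rscale V c (T \<phi>))\<rparr>"

text \<open>\<open>(F, W)\<close> is the functor morphing of the irreducible representation \<open>V\<close> of \<open>Aut\<^sub>R(M)\<close>,
  representations being taken up to isomorphism.  The functors \<open>G\<close> range over the universe \<open>'g\<close> of
  values of \<open>F\<close>; when \<open>'g\<close> is infinite this is every functor up to isomorphism.\<close>

definition functor_morphing ::
    "'r ring \<Rightarrow> ('r, 'u) module set \<Rightarrow> ('r, 'u) module \<Rightarrow>
     ('u \<Rightarrow> 'u, 'v::ab_group_add) group_rep \<Rightarrow> ('r, 'u, 'g) modfunctor \<Rightarrow>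
     (('r, 'u) module \<Rightarrow> 'g \<Rightarrow> 'g, 'w::ab_group_add) group_rep \<Rightarrow> bool" where
  "functor_morphing R C M V F W \<longleftrightarrow>
     additive_functor R C F \<and>
     intertwiners (aut_group R M) (KF_mod F M) V \<noteq> {0} \<and>
     (\<forall>G :: ('r, 'u, 'g) modfunctor. additive_functor R C G \<and> strictly_below R C G F \<longrightarrow>
        intertwiners (aut_group R M) (KF_mod G M) V = {0}) \<and>
     rep_iso (functor_aut_group R C F) W (morphing_rep R C M F V)"

end

theory Submission
  imports Defs
begin

text \<open>A nonzero intertwiner \<open>KF(M) \<rightarrow> V\<close> does not vanish on some \<open>u\<^sub>v\<close>, so it stays nonzero on
  \<open>KG(M)\<close>, where \<open>G \<subseteq> F\<close> is the subfunctor generated by \<open>v \<in> F(M)\<close>; minimality of \<open>F\<close> forces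
  \<open>G = F\<close>.  Let \<open>x \<in> F(X)\<close> be the generator given by the projective cover \<open>Hom(X, -) \<rightarrow> F\<close>.  Then
  \<open>v = F(h)(x)\<close> and \<open>x = F(k)(v)\<close> for some \<open>h : X \<rightarrow> M\<close> and \<open>k : M \<rightarrow> X\<close>.  As \<open>F(kh)(x) = x\<close>, the
  subfunctor of \<open>Hom(X, -)\<close> generated by \<open>kh\<close>, together with the superfluous kernel of the cover,
  is everything.  Hence \<open>kh\<close> generates \<open>Hom(X, -)\<close>, that is, \<open>kh\<close> has a left inverse, and \<open>h\<close>
  is a split monomorphism.\<close>

section \<open>Module homomorphisms\<close>

lemma left_module_smult_zero:
  assumes "left_module R M" "r \<in> carrier R"
  shows "r \<odot>\<^bsub>M\<^esub> \<zero>\<^bsub>M\<^esub> = \<zero>\<^bsub>M\<^esub>"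
proof -
  interpret left_module R M by fact
  have "r \<odot>\<^bsub>M\<^esub> \<zero>\<^bsub>M\<^esub> \<oplus>\<^bsub>M\<^esub> r \<odot>\<^bsub>M\<^esub> \<zero>\<^bsub>M\<^esub> = r \<odot>\<^bsub>M\<^esub> \<zero>\<^bsub>M\<^esub>"
    using smult_r_distr[of r "\<zero>\<^bsub>M\<^esub>" "\<zero>\<^bsub>M\<^esub>"] assms by simp
  then show ?thesis
    using assms(2) smult_closed by (metis M.zero_closed M.add.l_cancel_one')
qed

lemma left_module_smult_minus:
  assumes "left_module R M" "r \<in> carrier R" "x \<in> carrier M"
  shows "r \<odot>\<^bsub>M\<^esub> (\<ominus>\<^bsub>M\<^esub> x) = \<ominus>\<^bsub>M\<^esub> (r \<odot>\<^bsub>M\<^esub> x)"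
proof -
  interpret left_module R M by fact
  have "r \<odot>\<^bsub>M\<^esub> (\<ominus>\<^bsub>M\<^esub> x) \<oplus>\<^bsub>M\<^esub> r \<odot>\<^bsub>M\<^esub> x = \<zero>\<^bsub>M\<^esub>"
    using smult_r_distr[of r "\<ominus>\<^bsub>M\<^esub> x" x] left_module_smult_zero[OF assms(1,2)] assms
    by (simp add: M.l_neg)
  then show ?thesis
    using assms smult_closed by (metis M.a_inv_closed M.minus_equality)
qed

lemma mod_hom_add_hom:
  assumes "h \<in> mod_hom R X Y"
  shows "h \<in> hom (add_monoid X) (add_monoid Y)"
  using assms by (auto simp: mod_hom_def hom_def)

text \<open>Passing to the additive monoids gives access to the facts on group homomorphisms:
  preservation of zero and of inverses, and the subgroups formed by images and kernels.\<close>

lemma mod_hom_group_hom: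
  assumes "left_module R X" "left_module R Y" "h \<in> mod_hom R X Y"
  shows "group_hom (add_monoid X) (add_monoid Y) h"
  using assms mod_hom_add_hom[OF assms(3)]
  by (simp add: group_hom_def group_hom_axioms_def left_module_def abelian_group.a_group)

lemma mod_hom_zero:
  assumes "left_module R X" "left_module R Y" "h \<in> mod_hom R X Y"
  shows "h \<zero>\<^bsub>X\<^esub> = \<zero>\<^bsub>Y\<^esub>"
  using group_hom.hom_one[OF mod_hom_group_hom[OF assms]] by simp

lemma mod_hom_minus:
  assumes "left_module R X" "left_module R Y" "h \<in> mod_hom R X Y" "x \<in> carrier X"
  shows "h (\<ominus>\<^bsub>X\<^esub> x) = \<ominus>\<^bsub>Y\<^esub> (h x)"
  using group_hom.hom_inv[OF mod_hom_group_hom[OF assms(1-3)]] assms(4) by (simp add: a_inv_def)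

lemma mod_hom_closed: "\<lbrakk>h \<in> mod_hom R X Y; x \<in> carrier X\<rbrakk> \<Longrightarrow> h x \<in> carrier Y"
  by (auto simp: mod_hom_def)

lemma mod_hom_add:
  "\<lbrakk>h \<in> mod_hom R X Y; x \<in> carrier X; y \<in> carrier X\<rbrakk> \<Longrightarrow> h (x \<oplus>\<^bsub>X\<^esub> y) = h x \<oplus>\<^bsub>Y\<^esub> h y"
  by (auto simp: mod_hom_def)

lemma mod_hom_smult:
  "\<lbrakk>h \<in> mod_hom R X Y; r \<in> carrier R; x \<in> carrier X\<rbrakk> \<Longrightarrow> h (r \<odot>\<^bsub>X\<^esub> x) = r \<odot>\<^bsub>Y\<^esub> h x"
  by (auto simp: mod_hom_def)

text \<open>Since \<open>X\<close> is a module, sums and scalar multiples stay in its carrier. There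
  the restriction agrees with \<open>h\<close>, so the laws need checking only for the unrestricted
  map.\<close>

lemma mod_hom_restrictI:
  assumes "left_module R X"
    and "\<And>x. x \<in> carrier X \<Longrightarrow> h x \<in> carrier Y"
    and "\<And>x y. \<lbrakk>x \<in> carrier X; y \<in> carrier X\<rbrakk> \<Longrightarrow> h (x \<oplus>\<^bsub>X\<^esub> y) = h x \<oplus>\<^bsub>Y\<^esub> h y"
    and "\<And>r x. \<lbrakk>r \<in> carrier R; x \<in> carrier X\<rbrakk> \<Longrightarrow> h (r \<odot>\<^bsub>X\<^esub> x) = r \<odot>\<^bsub>Y\<^esub> h x"
  shows "(\<lambda>x\<in>carrier X. h x) \<in> mod_hom R X Y"
proof -
  interpret left_module R X by fact
  show ?thesis using assms smult_closed by (auto simp: mod_hom_def)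
qed

lemma mod_id_hom: "left_module R X \<Longrightarrow> mod_id X \<in> mod_hom R X X"
  unfolding mod_id_def by (rule mod_hom_restrictI) auto

lemma mod_hom_compose:
  assumes "left_module R X" "h \<in> mod_hom R X Y" "k \<in> mod_hom R Y Z"
  shows "compose (carrier X) k h \<in> mod_hom R X Z"
  unfolding compose_def using assms
  by (intro mod_hom_restrictI) (auto simp: mod_hom_closed mod_hom_add mod_hom_smult)

text \<open>This and the next two lemmas provide zero, negatives and sums in Hom(X, Y). Through
  additivity of a functor they become the unit, inverses and products in a generated
  subfunctor.\<close>

lemma zero_mod_hom:
  assumes "left_module R X" "left_module R Y"
  shows "(\<lambda>x\<in>carrier X. \<zero>\<^bsub>Y\<^esub>) \<in> mod_hom R X Y"
proof -
  interpret Y: left_module R Y by fact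
  show ?thesis using assms left_module_smult_zero[OF assms(2)]
    by (intro mod_hom_restrictI) auto
qed

lemma uminus_mod_hom:
  assumes "left_module R X" "left_module R Y" "h \<in> mod_hom R X Y"
  shows "(\<lambda>x\<in>carrier X. \<ominus>\<^bsub>Y\<^esub> (h x)) \<in> mod_hom R X Y"
proof -
  interpret Y: left_module R Y by fact
  show ?thesis using assms
    by (intro mod_hom_restrictI)
      (auto simp: mod_hom_closed mod_hom_add mod_hom_smult left_module_smult_minus Y.M.minus_add)
qed

lemma hom_add_mod_hom:
  assumes "left_module R X" "left_module R Y" "h \<in> mod_hom R X Y" "k \<in> mod_hom R X Y"
  shows "hom_add X Y h k \<in> mod_hom R X Y"
proof -
  interpret Y: left_module R Y by fact
  show ?thesis unfolding hom_add_def using assms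
    by (intro mod_hom_restrictI)
      (auto simp: mod_hom_closed mod_hom_add mod_hom_smult Y.smult_r_distr Y.M.a_ac)
qed

text \<open>The composite of \<open>q\<close> followed by \<open>h\<close> is an idempotent
  endomorphism of \<open>M\<close>. It splits \<open>M\<close> into its image \<open>A\<close> and
  its kernel, which is the kernel \<open>B\<close> of \<open>q\<close> because \<open>h\<close> is
  injective.\<close>

lemma iso_to_summand_if_retract:
  assumes X: "left_module R X" and M: "left_module R M"
    and h: "h \<in> mod_hom R X M" and q: "q \<in> mod_hom R M X"
    and qh: "\<And>x. x \<in> carrier X \<Longrightarrow> q (h x) = x"
  shows "iso_to_summand R X M"
proof -
  interpret X: left_module R X by fact
  interpret M: left_module R M by fact
  interpret h: group_hom "add_monoid X" "add_monoid M" h using mod_hom_group_hom[OF X M h] .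
  interpret q: group_hom "add_monoid M" "add_monoid X" q using mod_hom_group_hom[OF M X q] .
  define A where "A = h ` carrier X"
  define B where "B = {m \<in> carrier M. q m = \<zero>\<^bsub>X\<^esub>}"
  note closed = mod_hom_closed[OF h] mod_hom_closed[OF q]
  have A: "submodule A R M"
  proof (unfold submodule_def submodule_axioms_def, intro conjI allI impI)
    show "subgroup A (add_monoid M)"
      unfolding A_def using h.img_is_subgroup by simp
    fix r x assume "r \<in> carrier R" "x \<in> A"
    then obtain y where "y \<in> carrier X" "x = h y" by (auto simp: A_def)
    then have "r \<odot>\<^bsub>M\<^esub> x = h (r \<odot>\<^bsub>X\<^esub> y)" "r \<odot>\<^bsub>X\<^esub> y \<in> carrier X"
      using \<open>r \<in> carrier R\<close> mod_hom_smult[OF h] X.smult_closed by auto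
    then show "r \<odot>\<^bsub>M\<^esub> x \<in> A" by (auto simp: A_def)
  qed
  have B: "submodule B R M"
  proof (unfold submodule_def submodule_axioms_def, intro conjI allI impI)
    show "subgroup B (add_monoid M)"
      using q.subgroup_kernel by (simp add: B_def kernel_def)
    fix r x assume "r \<in> carrier R" "x \<in> B"
    then show "r \<odot>\<^bsub>M\<^esub> x \<in> B"
      using mod_hom_smult[OF q] M.smult_closed left_module_smult_zero[OF X] by (auto simp: B_def)
  qed
  \<comment> \<open>If \<open>h y\<close> lies in the kernel of \<open>q\<close>, then
    \<open>y = q (h y)\<close> is zero, and so is \<open>h y\<close>.\<close>
  have "A \<inter> B = {\<zero>\<^bsub>M\<^esub>}"
    using qh mod_hom_zero[OF X M h] mod_hom_zero[OF M X q] by (force simp: A_def B_def)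
  moreover have "A <+>\<^bsub>M\<^esub> B = carrier M"
  proof (intro equalityI subsetI)
    show "m \<in> carrier M" if "m \<in> A <+>\<^bsub>M\<^esub> B" for m
      using that closed by (auto simp: set_add_def set_mult_def A_def B_def)
  next
    fix m assume m: "m \<in> carrier M"
    \<comment> \<open>The two components of \<open>m\<close> under the idempotent and its
      complement; \<open>q\<close> kills \<open>?b\<close> because
      \<open>q (h (q m)) = q m\<close>.\<close>
    let ?a = "h (q m)" and ?b = "\<ominus>\<^bsub>M\<^esub> h (q m) \<oplus>\<^bsub>M\<^esub> m"
    have "?b \<in> B"
      using m closed qh
      by (simp add: B_def mod_hom_add[OF q] mod_hom_minus[OF M X q] X.M.l_neg)
    moreover have "m = ?a \<oplus>\<^bsub>M\<^esub> ?b"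
      using m closed by (simp add: M.M.r_neg M.M.a_assoc[symmetric])
    ultimately show "m \<in> A <+>\<^bsub>M\<^esub> B"
      using m closed by (auto simp: set_add_def set_mult_def A_def)
  qed
  ultimately have "internal_sum R M A B" using A B by (simp add: internal_sum_def)
  moreover have "mod_iso R X (M\<lparr>carrier := A\<rparr>)"
  proof -
    have "h \<in> mod_hom R X (M\<lparr>carrier := A\<rparr>)"
      using h by (auto simp: mod_hom_def A_def)
    moreover have "bij_betw h (carrier X) A"
      using qh by (auto simp: A_def bij_betw_def intro: inj_on_inverseI)
    ultimately show ?thesis by (auto simp: mod_iso_def)
  qed
  ultimately show ?thesis by (auto simp: iso_to_summand_def)
qed

section \<open>Subfunctors\<close>

lemma additive_functor_comm_group:
  "\<lbrakk>additive_functor R C F; N \<in> C\<rbrakk> \<Longrightarrow> comm_group (fobj F N)"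
  by (simp add: additive_functor_def)

lemma additive_functor_finite:
  "\<lbrakk>additive_functor R C F; N \<in> C\<rbrakk> \<Longrightarrow> finite (carrier (fobj F N))"
  by (simp add: additive_functor_def)

lemma additive_functor_hom:
  "\<lbrakk>additive_functor R C F; N \<in> C; N' \<in> C; h \<in> mod_hom R N N'\<rbrakk> \<Longrightarrow>
     fmap F N N' h \<in> hom (fobj F N) (fobj F N')"
  by (simp add: additive_functor_def)

lemma additive_functor_id:
  "\<lbrakk>additive_functor R C F; N \<in> C; v \<in> carrier (fobj F N)\<rbrakk> \<Longrightarrow> fmap F N N (mod_id N) v = v"
  by (simp add: additive_functor_def)

lemma additive_functor_compose:
  "\<lbrakk>additive_functor R C F; L \<in> C; N \<in> C; N' \<in> C; h \<in> mod_hom R L N; k \<in> mod_hom R N N';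
     v \<in> carrier (fobj F L)\<rbrakk> \<Longrightarrow>
     fmap F L N' (compose (carrier L) k h) v = fmap F N N' k (fmap F L N h v)"
  by (simp add: additive_functor_def)

lemma additive_functor_add:
  "\<lbrakk>additive_functor R C F; N \<in> C; N' \<in> C; h \<in> mod_hom R N N'; k \<in> mod_hom R N N';
     v \<in> carrier (fobj F N)\<rbrakk> \<Longrightarrow>
     fmap F N N' (hom_add N N' h k) v = fmap F N N' h v \<otimes>\<^bsub>fobj F N'\<^esub> fmap F N N' k v"
  by (simp add: additive_functor_def)

lemma subfunctor_subgroup: "\<lbrakk>subfunctor R C G F; N \<in> C\<rbrakk> \<Longrightarrow> subgroup (G N) (fobj F N)"
  by (simp add: subfunctor_def)

lemma subfunctor_subset: "\<lbrakk>subfunctor R C G F; N \<in> C\<rbrakk> \<Longrightarrow> G N \<subseteq> carrier (fobj F N)"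
  by (simp add: subfunctor_def subgroup.subset)

lemma subfunctor_closed:
  "\<lbrakk>subfunctor R C G F; N \<in> C; N' \<in> C; h \<in> mod_hom R N N'; v \<in> G N\<rbrakk> \<Longrightarrow>
     fmap F N N' h v \<in> G N'"
  unfolding subfunctor_def by blast

section \<open>Subfunctors generated by a single element\<close>

text \<open>This is the image of the Yoneda map Hom(M, -) to F determined by \<open>v\<close>. No
  closure under sums has to be imposed: for an additive functor, sums of values at \<open>v\<close>
  are again values at \<open>v\<close>.\<close>

definition generated_subfunctor ::
    "'r ring \<Rightarrow> ('r, 'u, 'g) modfunctor \<Rightarrow> ('r, 'u) module \<Rightarrow> 'g \<Rightarrow> ('r, 'u) module \<Rightarrow> 'g set" where
  "generated_subfunctor R F M v N = (\<lambda>k. fmap F M N k v) ` mod_hom R M N"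

text \<open>Additivity of \<open>F\<close> in the morphism turns the group structure of Hom(M, N)
  into the subgroup property; functoriality gives stability under maps from \<open>N\<close> to
  \<open>N'\<close>.\<close>

lemma generated_subfunctor_subfunctor:
  assumes F: "additive_functor R C F" and C: "\<And>N. N \<in> C \<Longrightarrow> left_module R N"
    and M: "M \<in> C" and v: "v \<in> carrier (fobj F M)"
  shows "subfunctor R C (generated_subfunctor R F M v) F"
  unfolding subfunctor_def
proof (intro conjI ballI)
  fix N assume N: "N \<in> C"
  interpret N: left_module R N using C N .
  interpret FN: comm_group "fobj F N" using additive_functor_comm_group[OF F N] .
  have map: "fmap F M N k v \<in> carrier (fobj F N)" if "k \<in> mod_hom R M N" for k
    using hom_in_carrier[OF additive_functor_hom[OF F M N that] v] .
  have add: "fmap F M N (hom_add M N h k) v = fmap F M N h v \<otimes>\<^bsub>fobj F N\<^esub> fmap F M N k v"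
    if "h \<in> mod_hom R M N" "k \<in> mod_hom R M N" for h k
    using additive_functor_add[OF F M N that v] .
  let ?z = "\<lambda>x\<in>carrier M. \<zero>\<^bsub>N\<^esub>"
  have z: "?z \<in> mod_hom R M N" using zero_mod_hom C M N by blast
  \<comment> \<open>The value of \<open>F\<close> on the zero map at \<open>v\<close> is therefore
    idempotent in a group, hence the unit.\<close>
  have "hom_add M N ?z ?z = ?z" by (auto simp: hom_add_def)
  then have z1: "fmap F M N ?z v = \<one>\<^bsub>fobj F N\<^esub>"
    using add[OF z z] map[OF z] by (metis FN.l_cancel_one')
  show "subgroup (generated_subfunctor R F M v N) (fobj F N)"
  proof (rule FN.subgroupI)
    show "generated_subfunctor R F M v N \<subseteq> carrier (fobj F N)"
      using map by (auto simp: generated_subfunctor_def)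
    show "generated_subfunctor R F M v N \<noteq> {}"
      using z by (auto simp: generated_subfunctor_def)
    show "a \<otimes>\<^bsub>fobj F N\<^esub> b \<in> generated_subfunctor R F M v N"
      if ab: "a \<in> generated_subfunctor R F M v N" "b \<in> generated_subfunctor R F M v N" for a b
    proof -
      obtain h k where hk: "h \<in> mod_hom R M N" "k \<in> mod_hom R M N"
        "a = fmap F M N h v" "b = fmap F M N k v"
        using ab by (auto simp: generated_subfunctor_def)
      then have "a \<otimes>\<^bsub>fobj F N\<^esub> b = fmap F M N (hom_add M N h k) v" by (simp add: add)
      then show ?thesis
        using hom_add_mod_hom[OF C[OF M] C[OF N] hk(1,2)] by (simp add: generated_subfunctor_def)
    qed
    show "inv\<^bsub>fobj F N\<^esub> a \<in> generated_subfunctor R F M v N"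
      if a: "a \<in> generated_subfunctor R F M v N" for a
    proof -
      obtain k where k: "k \<in> mod_hom R M N" and ak: "a = fmap F M N k v"
        using a by (auto simp: generated_subfunctor_def)
      let ?k = "\<lambda>x\<in>carrier M. \<ominus>\<^bsub>N\<^esub> (k x)"
      have k': "?k \<in> mod_hom R M N" using uminus_mod_hom C M N k by blast
      \<comment> \<open>Additivity makes the value at the negative of \<open>k\<close> a left
        inverse of \<open>a\<close>.\<close>
      have "hom_add M N ?k k = ?z"
        using mod_hom_closed[OF k] by (auto simp: hom_add_def N.M.l_neg)
      then have "fmap F M N ?k v \<otimes>\<^bsub>fobj F N\<^esub> a = \<one>\<^bsub>fobj F N\<^esub>"
        using add[OF k' k] z1 ak by simp
      then have "inv\<^bsub>fobj F N\<^esub> a = fmap F M N ?k v"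
        using map k k' ak by (metis FN.inv_equality)
      then show ?thesis using k' by (auto simp: generated_subfunctor_def)
    qed
  qed
next
  fix N N' h assume N: "N \<in> C" "N' \<in> C" "h \<in> mod_hom R N N'"
  have "fmap F N N' h (fmap F M N k v) = fmap F M N' (compose (carrier M) h k) v"
    if "k \<in> mod_hom R M N" for k
    using additive_functor_compose[OF F M N(1,2) that N(3) v] by simp
  then show "fmap F N N' h ` generated_subfunctor R F M v N \<subseteq> generated_subfunctor R F M v N'"
    using mod_hom_compose[OF C[OF M] _ N(3)] by (auto simp: generated_subfunctor_def)
qed

lemma generator_in_generated_subfunctor:
  assumes "additive_functor R C F" "left_module R M" "M \<in> C" "v \<in> carrier (fobj F M)"
  shows "v \<in> generated_subfunctor R F M v M"
proof -
  have "fmap F M M (mod_id M) v = v" using additive_functor_id[OF assms(1,3,4)] .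
  then show ?thesis
    unfolding generated_subfunctor_def by (rule image_eqI[OF sym mod_id_hom[OF assms(2)]])
qed

section \<open>Subfunctors as functors below the ambient functor\<close>

text \<open>Minimality in \<open>functor_morphing\<close> is tested against additive functors with
  values in the same type as \<open>F\<close>. Restriction keeps that type, so a subfunctor becomes
  an admissible test object.\<close>

lemma additive_functor_restrict:
  assumes F: "additive_functor R C F" and G: "subfunctor R C G F"
    and C: "\<And>N. N \<in> C \<Longrightarrow> left_module R N"
  shows "additive_functor R C (restrict_functor F G)"
proof -
  have sub: "G N \<subseteq> carrier (fobj F N)" if "N \<in> C" for N
    using subfunctor_subset[OF G that] .
  have "comm_group ((fobj F N)\<lparr>carrier := G N\<rparr>)" if "N \<in> C" for N
  proof -
    interpret comm_group "fobj F N" using additive_functor_comm_group[OF F that] .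
    have "group ((fobj F N)\<lparr>carrier := G N\<rparr>)"
      using subgroup.subgroup_is_group[OF subfunctor_subgroup[OF G that] is_group] .
    then show ?thesis
      using sub[OF that] by (auto intro!: group.group_comm_groupI m_comm)
  qed
  moreover have "finite (G N)" if "N \<in> C" for N
    using finite_subset[OF sub[OF that] additive_functor_finite[OF F that]] .
  moreover have "fmap F N N' h \<in> hom ((fobj F N)\<lparr>carrier := G N\<rparr>) ((fobj F N')\<lparr>carrier := G N'\<rparr>)"
    if "N \<in> C" "N' \<in> C" "h \<in> mod_hom R N N'" for N N' h
  proof -
    have "fmap F N N' h v \<in> G N'" if "v \<in> G N" for v
      using subfunctor_closed[OF G] \<open>N \<in> C\<close> \<open>N' \<in> C\<close> \<open>h \<in> mod_hom R N N'\<close> that by blast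
    then show ?thesis
      using hom_mult[OF additive_functor_hom[OF F that]] sub[OF that(1)]
      by (auto simp: hom_def subset_iff)
  qed
  moreover have "\<forall>N\<in>C. \<forall>v\<in>G N. fmap F N N (mod_id N) v = v"
    using additive_functor_id[OF F] sub by blast
  moreover have "\<forall>X\<in>C. \<forall>Y\<in>C. \<forall>Z\<in>C. \<forall>h\<in>mod_hom R X Y. \<forall>k\<in>mod_hom R Y Z. \<forall>v\<in>G X.
        fmap F X Z (compose (carrier X) k h) v = fmap F Y Z k (fmap F X Y h v)"
    using additive_functor_compose[OF F] sub by (intro ballI) (blast dest: subsetD)
  moreover have "\<forall>X\<in>C. \<forall>Y\<in>C. \<forall>h\<in>mod_hom R X Y. \<forall>k\<in>mod_hom R X Y. \<forall>v\<in>G X.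
        fmap F X Y (hom_add X Y h k) v = fmap F X Y h v \<otimes>\<^bsub>fobj F Y\<^esub> fmap F X Y k v"
    using additive_functor_add[OF F] sub by (intro ballI) (blast dest: subsetD)
  ultimately show ?thesis
    by (simp add: additive_functor_def restrict_functor_def)
qed

text \<open>The relation \<open>strictly_below\<close> speaks only of subquotients, so a subfunctor
  has to be presented as its quotient by the trivial subfunctor.\<close>

lemma restrict_iso_subquotient:
  assumes F: "additive_functor R C F" and G: "subfunctor R C G F"
  shows "functor_iso R C (restrict_functor F G) (subquotient F G (\<lambda>N. {\<one>\<^bsub>fobj F N\<^esub>}))"
proof -
  let ?Q = "subquotient F G (\<lambda>N. {\<one>\<^bsub>fobj F N\<^esub>})"
  \<comment> \<open>The coset of the trivial subgroup containing \<open>v\<close> is the singleton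
    of \<open>v\<close>.\<close>
  define \<alpha> where "\<alpha> = (\<lambda>N\<in>C. \<lambda>v\<in>G N. {v})"
  have grp: "comm_group (fobj F N)" "G N \<subseteq> carrier (fobj F N)" if "N \<in> C" for N
    using additive_functor_comm_group[OF F that] subfunctor_subset[OF G that] by blast+
  have Q: "carrier (fobj ?Q N) = (\<lambda>v. {v}) ` G N" if "N \<in> C" for N
  proof -
    interpret comm_group "fobj F N" using grp that by blast
    show ?thesis using grp(2)[OF that]
      by (force simp: subquotient_def FactGroup_def RCOSETS_def r_coset_def)
  qed
  have "\<alpha> \<in> nat_trans R C (restrict_functor F G) ?Q"
    unfolding nat_trans_def
  proof (intro CollectI conjI ballI)
    show "\<alpha> \<in> extensional C" by (simp add: \<alpha>_def)
    fix N assume N: "N \<in> C"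
    show "\<alpha> N \<in> extensional (carrier (fobj (restrict_functor F G) N))"
      using N by (simp add: \<alpha>_def restrict_functor_def)
    show "\<alpha> N \<in> hom (fobj (restrict_functor F G) N) (fobj ?Q N)"
      using N subgroup.m_closed[OF subfunctor_subgroup[OF G N]] Q[OF N]
      by (simp add: hom_def \<alpha>_def restrict_functor_def)
        (simp add: subquotient_def FactGroup_def set_mult_def)
    fix N' h v assume N': "N' \<in> C" and h: "h \<in> mod_hom R N N'"
      and v: "v \<in> carrier (fobj (restrict_functor F G) N)"
    interpret N': comm_group "fobj F N'" using grp N' by blast
    have v': "v \<in> G N" "v \<in> carrier (fobj F N)"
      using v grp(2)[OF N] by (auto simp: restrict_functor_def)
    have "fmap F N N' h v \<in> G N'" using subfunctor_closed[OF G N N' h v'(1)] .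
    moreover then have "fmap F N N' h v \<in> carrier (fobj F N')" using grp(2)[OF N'] by blast
    ultimately show "\<alpha> N' (fmap (restrict_functor F G) N N' h v) = fmap ?Q N N' h (\<alpha> N v)"
      using N N' v' by (simp add: \<alpha>_def restrict_functor_def subquotient_def set_mult_def)
  qed
  moreover have "bij_betw (\<alpha> N) (carrier (fobj (restrict_functor F G) N)) (carrier (fobj ?Q N))"
    if "N \<in> C" for N
    using that Q[OF that] by (auto simp: bij_betw_def inj_on_def \<alpha>_def restrict_functor_def)
  ultimately show ?thesis unfolding functor_iso_def by blast
qed

lemma trivial_subfunctor:
  assumes F: "additive_functor R C F"
  shows "subfunctor R C (\<lambda>N. {\<one>\<^bsub>fobj F N\<^esub>}) F"
  unfolding subfunctor_def
proof (intro conjI ballI)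
  show "subgroup {\<one>\<^bsub>fobj F N\<^esub>} (fobj F N)" if "N \<in> C" for N
    using additive_functor_comm_group[OF F that] by (simp add: comm_group.axioms(2) group.triv_subgroup)
  show "fmap F N N' h ` {\<one>\<^bsub>fobj F N\<^esub>} \<subseteq> {\<one>\<^bsub>fobj F N'\<^esub>}"
    if "N \<in> C" "N' \<in> C" "h \<in> mod_hom R N N'" for N N' h
    using hom_one[OF additive_functor_hom[OF F that]] that additive_functor_comm_group[OF F]
    by (simp add: comm_group.axioms(2))
qed

text \<open>An abstract isomorphism need not be the inclusion, so properness alone does not exclude
  one. Finiteness does: a proper subset of a finite set has smaller cardinality.\<close>

lemma proper_subfunctor_strictly_below:
  assumes F: "additive_functor R C F" and G: "subfunctor R C G F"
    and N: "N \<in> C" "G N \<noteq> carrier (fobj F N)"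
  shows "strictly_below R C (restrict_functor F G) F"
proof -
  have "\<not> functor_iso R C (restrict_functor F G) F"
  proof
    assume "functor_iso R C (restrict_functor F G) F"
    then have "card (G N) = card (carrier (fobj F N))"
      using N(1) by (auto simp: functor_iso_def restrict_functor_def dest!: bij_betw_same_card)
    moreover have "finite (carrier (fobj F N))" "G N \<subseteq> carrier (fobj F N)"
      using additive_functor_finite[OF F N(1)] subfunctor_subset[OF G N(1)] by blast+
    ultimately show False using N(2) by (metis card_subset_eq)
  qed
  moreover have "\<forall>N\<in>C. {\<one>\<^bsub>fobj F N\<^esub>} \<subseteq> G N"
    using subgroup.one_closed[OF subfunctor_subgroup[OF G]] by blast
  ultimately show ?thesis
    unfolding strictly_below_def
    using restrict_iso_subquotient[OF F G] trivial_subfunctor[OF F] G by blast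
qed

section \<open>Permutation representations\<close>

text \<open>A function supported in a finite set is a finite combination of basis vectors. As
  \<open>T\<close> is linear only on functions supported in \<open>S\<close>, the proof is an
  induction on a finite set \<open>A\<close> inside \<open>S\<close> containing the support.\<close>

lemma linear_zero_if_zero_on_basis_vecs:
  fixes T :: "('g \<Rightarrow> complex) \<Rightarrow> 'v::ab_group_add"
  assumes V: "vector_space s" and S: "finite S"
    and add: "\<And>\<phi> \<psi>. \<lbrakk>\<forall>x. x \<notin> S \<longrightarrow> \<phi> x = 0; \<forall>x. x \<notin> S \<longrightarrow> \<psi> x = 0\<rbrakk> \<Longrightarrow> T (\<phi> + \<psi>) = T \<phi> + T \<psi>"
    and scale: "\<And>c \<phi>. \<forall>x. x \<notin> S \<longrightarrow> \<phi> x = 0 \<Longrightarrow> T (\<lambda>x. c * \<phi> x) = s c (T \<phi>)"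
    and basis: "\<And>v. v \<in> S \<Longrightarrow> T (basis_vec v) = 0"
    and \<phi>: "\<forall>x. x \<notin> S \<longrightarrow> \<phi> x = 0"
  shows "T \<phi> = 0"
proof -
  interpret vector_space s by fact
  have "T \<phi> = 0" if "finite A" "A \<subseteq> S" "\<forall>x. x \<notin> A \<longrightarrow> \<phi> x = 0" for A \<phi>
    using that
  proof (induction A arbitrary: \<phi> rule: finite_induct)
    case empty
    \<comment> \<open>Here the function is zero; writing it as its own multiple by 0 lets
      \<open>scale\<close> apply.\<close>
    then have "T \<phi> = T (\<lambda>x. 0 * \<phi> x)" by (intro arg_cong[where f = T]) auto
    also have "\<dots> = 0" using empty by (subst scale) auto
    finally show ?case .
  next
    case (insert v A)
    \<comment> \<open>The coordinate at \<open>v\<close> is split off, leaving a function supported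
      in the smaller set.\<close>
    let ?\<psi> = "\<phi>(v := 0)" and ?\<chi> = "\<lambda>x. \<phi> v * basis_vec v x"
    have "\<phi> = ?\<psi> + ?\<chi>" by (auto simp: basis_vec_def)
    moreover have "T (?\<psi> + ?\<chi>) = T ?\<psi> + T ?\<chi>"
      using insert.prems by (intro add) (auto simp: basis_vec_def)
    moreover have "T ?\<psi> = 0" using insert.prems insert.hyps by (intro insert.IH) auto
    moreover have "T ?\<chi> = s (\<phi> v) (T (basis_vec v))"
      using insert.prems by (intro scale) (auto simp: basis_vec_def)
    ultimately show ?case using basis insert.prems by simp
  qed
  then show ?thesis using S \<phi> by blast
qed

lemma nonzero_intertwiner_basis_vec:
  assumes V: "representation_of H V" and S: "finite S"
    and ne: "intertwiners H (perm_rep S p) V \<noteq> {0}"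
  obtains T v where "T \<in> intertwiners H (perm_rep S p) V" "v \<in> S" "T (basis_vec v) \<noteq> 0"
proof -
  have vs: "vector_space (rscale V)" using V by (simp add: representation_of_def)
  interpret vector_space "rscale V" by fact
  have sub: "subspace (rspace V)" using V by (simp add: representation_of_def)
  \<comment> \<open>A set different from \<open>{0}\<close> might be empty. The zero map is first
    shown to be an intertwiner, for which each group element must fix 0; only then does
    \<open>ne\<close> yield a nonzero one.\<close>
  have "ract V g 0 = 0" if "g \<in> carrier H" for g
  proof -
    have "ract V g (rscale V 0 0) = rscale V 0 (ract V g 0)"
      using V that subspace_0[OF sub] unfolding representation_of_def by blast
    then show ?thesis by simp
  qed
  then have "0 \<in> intertwiners H (perm_rep S p) V"
    using subspace_0[OF sub] by (auto simp: intertwiners_def)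
  then obtain T where T: "T \<in> intertwiners H (perm_rep S p) V" "T \<noteq> 0" using ne by blast
  then obtain \<phi> where "T \<phi> \<noteq> 0" by (auto simp: fun_eq_iff)
  moreover then have "\<phi> \<in> rspace (perm_rep S p)" using T by (auto simp: intertwiners_def)
  ultimately have "\<exists>v\<in>S. T (basis_vec v) \<noteq> 0"
    using linear_zero_if_zero_on_basis_vecs[OF vs S, of T \<phi>] T
    by (auto simp: intertwiners_def perm_rep_def)
  then show ?thesis using T that by blast
qed

text \<open>An invariant subset of the basis spans a subrepresentation, and intertwiners restrict to
  it. The value 0 elsewhere follows the convention in \<open>intertwiners\<close>.\<close>

lemma perm_rep_intertwiner_restrict:
  assumes T: "T \<in> intertwiners H (perm_rep S p) V" and S: "finite S" and sub: "S' \<subseteq> S"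
    and p: "\<And>g v. \<lbrakk>g \<in> carrier H; v \<in> S'\<rbrakk> \<Longrightarrow> p g v \<in> S'"
  shows "(\<lambda>\<phi>. if \<phi> \<in> rspace (perm_rep S' p) then T \<phi> else 0) \<in> intertwiners H (perm_rep S' p) V"
    (is "?T \<in> _")
proof -
  have le: "\<phi> \<in> rspace (perm_rep S p)" if "\<phi> \<in> rspace (perm_rep S' p)" for \<phi>
    using that sub by (auto simp: perm_rep_def)
  \<comment> \<open>The terms indexed by the rest of \<open>S\<close> vanish, since the function is
    zero there.\<close>
  have act: "ract (perm_rep S' p) g \<phi> = ract (perm_rep S p) g \<phi>"
    if "\<phi> \<in> rspace (perm_rep S' p)" for g \<phi>
    using that sub S by (auto simp: perm_rep_def fun_eq_iff intro!: sum.mono_neutral_left)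
  have closed: "ract (perm_rep S' p) g \<phi> \<in> rspace (perm_rep S' p)"
    if "g \<in> carrier H" for g \<phi>
    using p[OF that] by (fastforce simp: perm_rep_def basis_vec_def intro!: sum.neutral)
  have add: "\<phi> + \<psi> \<in> rspace (perm_rep S' p)"
    if "\<phi> \<in> rspace (perm_rep S' p)" "\<psi> \<in> rspace (perm_rep S' p)" for \<phi> \<psi>
    using that by (auto simp: perm_rep_def)
  have scale: "rscale (perm_rep S' p) c \<phi> = rscale (perm_rep S p) c \<phi>"
    "rscale (perm_rep S' p) c \<phi> \<in> rspace (perm_rep S' p)"
    if "\<phi> \<in> rspace (perm_rep S' p)" for c \<phi>
    using that by (auto simp: perm_rep_def)
  have T_range: "T \<phi> \<in> rspace V"
    and T_add: "\<psi> \<in> rspace (perm_rep S p) \<Longrightarrow> T (\<phi> + \<psi>) = T \<phi> + T \<psi>"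
    and T_scale: "T (rscale (perm_rep S p) c \<phi>) = rscale V c (T \<phi>)"
    and T_act: "g \<in> carrier H \<Longrightarrow> T (ract (perm_rep S p) g \<phi>) = ract V g (T \<phi>)"
    if "\<phi> \<in> rspace (perm_rep S p)" for \<phi> \<psi> c g
    using T that by (auto simp: intertwiners_def)
  show ?thesis
    unfolding intertwiners_def
  proof (intro CollectI conjI allI ballI impI image_subsetI)
    show "?T \<phi> = 0" if "\<phi> \<notin> rspace (perm_rep S' p)" for \<phi>
      using that by simp
    show "?T \<phi> \<in> rspace V" if "\<phi> \<in> rspace (perm_rep S' p)" for \<phi>
      using that T_range[OF le[OF that]] by simp
    show "?T (\<phi> + \<psi>) = ?T \<phi> + ?T \<psi>"
      if "\<phi> \<in> rspace (perm_rep S' p)" "\<psi> \<in> rspace (perm_rep S' p)" for \<phi> \<psi>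
      using that add[OF that] T_add[OF le le] by simp
    show "?T (rscale (perm_rep S' p) c \<phi>) = rscale V c (?T \<phi>)"
      if "\<phi> \<in> rspace (perm_rep S' p)" for c \<phi>
      using that scale(2)[OF that, of c] scale(1)[OF that, of c] T_scale[OF le[OF that], of c]
      by simp
    show "?T (ract (perm_rep S' p) g \<phi>) = ract V g (?T \<phi>)"
      if "g \<in> carrier H" "\<phi> \<in> rspace (perm_rep S' p)" for g \<phi>
      using that closed[OF that(1), of \<phi>] act[OF that(2), of g] T_act[OF le[OF that(2)] that(1)]
      by simp
  qed
qed

section \<open>Generators\<close>

text \<open>A proper subfunctor generated by \<open>v\<close> would be strictly below
  \<open>F\<close> and still carry a nonzero intertwiner, the restriction of \<open>T\<close>.
  Minimality of \<open>F\<close> rules this out.\<close>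

lemma functor_morphing_generator:
  assumes fm: "functor_morphing R C M V F W" and V: "representation_of (aut_group R M) V"
    and C: "\<And>N. N \<in> C \<Longrightarrow> left_module R N" and M: "M \<in> C"
  obtains v where "v \<in> carrier (fobj F M)"
    "\<And>N. N \<in> C \<Longrightarrow> generated_subfunctor R F M v N = carrier (fobj F N)"
proof -
  have F: "additive_functor R C F" using fm by (simp add: functor_morphing_def)
  then have fin: "finite (carrier (fobj F M))" using additive_functor_finite[OF _ M] by blast
  have "intertwiners (aut_group R M) (KF_mod F M) V \<noteq> {0}" using fm by (simp add: functor_morphing_def)
  then obtain T v where T: "T \<in> intertwiners (aut_group R M) (KF_mod F M) V"
    and v: "v \<in> carrier (fobj F M)" and Tv: "T (basis_vec v) \<noteq> 0"
    using nonzero_intertwiner_basis_vec[OF V fin] unfolding KF_mod_def by blast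
  let ?G = "generated_subfunctor R F M v"
  have G: "subfunctor R C ?G F" using generated_subfunctor_subfunctor[OF F C M v] .
  have vG: "v \<in> ?G M" using generator_in_generated_subfunctor[OF F C[OF M] M v] .
  have KG: "KF_mod (restrict_functor F ?G) M = perm_rep (?G M) (\<lambda>g. fmap F M M g)"
    by (simp add: KF_mod_def restrict_functor_def)
  have "?G M \<subseteq> carrier (fobj F M)"
    using subfunctor_subset[OF G M] .
  moreover have "fmap F M M g w \<in> ?G M" if "g \<in> carrier (aut_group R M)" "w \<in> ?G M" for g w
  proof -
    have "g \<in> mod_hom R M M" using that by (simp add: aut_group_def)
    then show ?thesis using subfunctor_closed[OF G M M] that by blast
  qed
  ultimately have T': "(\<lambda>\<phi>. if \<phi> \<in> rspace (KF_mod (restrict_functor F ?G) M) then T \<phi> else 0)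
      \<in> intertwiners (aut_group R M) (KF_mod (restrict_functor F ?G) M) V" (is "?T \<in> _")
    unfolding KG using T[unfolded KF_mod_def] fin by (intro perm_rep_intertwiner_restrict)
  \<comment> \<open>As \<open>v\<close> belongs to its generated subfunctor, its basis vector
    survives the restriction and \<open>T\<close> keeps its value there.\<close>
  have "?T (basis_vec v) \<noteq> 0"
    using Tv vG unfolding KG by (auto simp: perm_rep_def basis_vec_def)
  then have "?T \<noteq> 0" using fun_cong[of ?T 0 "basis_vec v"] by auto
  then have "intertwiners (aut_group R M) (KF_mod (restrict_functor F ?G) M) V \<noteq> {0}"
    using T' by blast
  moreover have "additive_functor R C (restrict_functor F ?G)"
    using additive_functor_restrict[OF F G C] .
  ultimately have "\<not> strictly_below R C (restrict_functor F ?G) F"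
    using fm unfolding functor_morphing_def by blast
  then have "?G N = carrier (fobj F N)" if "N \<in> C" for N
    using proper_subfunctor_strictly_below[OF F G that] by blast
  then show ?thesis using that v by blast
qed

lemma projective_cover_hom_functor_generator:
  assumes C: "\<And>N. N \<in> C \<Longrightarrow> left_module R N" and X: "X \<in> C"
    and cover: "projective_cover R C (hom_functor R X) F p"
    and F: "additive_functor R C F"
  defines "x \<equiv> p X (mod_id X)"
  shows "x \<in> carrier (fobj F X)"
    and "\<And>N. N \<in> C \<Longrightarrow> generated_subfunctor R F X x N = carrier (fobj F N)"
    and "\<And>e. \<lbrakk>e \<in> mod_hom R X X; fmap F X X e x = x\<rbrakk> \<Longrightarrow>
           \<exists>g\<in>mod_hom R X X. compose (carrier X) g e = mod_id X"
proof -
  let ?P = "hom_functor R X"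
  have P: "additive_functor R C ?P"
    and p: "p \<in> nat_trans R C ?P F" and epi: "nat_epi C ?P F p"
    and sup: "superfluous R C (nat_kernel ?P F p) ?P"
    using cover by (auto simp: projective_cover_def projective_def)
  have carr: "carrier (fobj ?P N) = mod_hom R X N" for N by (simp add: hom_functor_def)
  have mapP: "fmap ?P N N' k h = compose (carrier X) k h" for N N' k h by (simp add: hom_functor_def)
  have id: "mod_id X \<in> mod_hom R X X" using mod_id_hom C X by blast
  have p_hom: "p N \<in> hom (fobj ?P N) (fobj F N)" if "N \<in> C" for N
    using p that by (auto simp: nat_trans_def)
  have nat: "p N' (compose (carrier X) k h) = fmap F N N' k (p N h)"
    if "N \<in> C" "N' \<in> C" "k \<in> mod_hom R N N'" "h \<in> mod_hom R X N" for N N' k h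
  proof -
    have "\<forall>h\<in>carrier (fobj ?P N). p N' (fmap ?P N N' k h) = fmap F N N' k (p N h)"
      using p that(1-3) by (simp add: nat_trans_def)
    then show ?thesis using that(4) by (simp add: carr mapP)
  qed
  \<comment> \<open>Equality holds on all arguments because \<open>h\<close> is extensional on the
    carrier of \<open>X\<close>.\<close>
  have comp_id: "compose (carrier X) h (mod_id X) = h" if "h \<in> mod_hom R X N" for h N
    using that by (auto simp: mod_hom_def mod_id_def compose_def fun_eq_iff PiE_def extensional_def)
  have yoneda: "p N h = fmap F X N h x" if "N \<in> C" "h \<in> mod_hom R X N" for N h
    using nat[OF X that(1) that(2) id] comp_id[OF that(2)] by (simp add: x_def)
  show x: "x \<in> carrier (fobj F X)"
    using p_hom[OF X] id by (auto simp: x_def hom_def carr)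
  show "generated_subfunctor R F X x N = carrier (fobj F N)" if "N \<in> C" for N
  proof -
    have "p N ` mod_hom R X N = carrier (fobj F N)" using epi that by (simp add: nat_epi_def carr)
    then show ?thesis using yoneda[OF that] by (simp add: generated_subfunctor_def)
  qed
  show "\<exists>g\<in>mod_hom R X X. compose (carrier X) g e = mod_id X"
    if e: "e \<in> mod_hom R X X" "fmap F X X e x = x" for e
  proof -
    \<comment> \<open>At \<open>N\<close> this consists of the maps from \<open>X\<close> to
      \<open>N\<close> that factor through \<open>e\<close> on the right.\<close>
    let ?L = "generated_subfunctor R ?P X e"
    have L: "subfunctor R C ?L ?P"
      using generated_subfunctor_subfunctor[OF P C X] e by (simp add: carr)
    have "?L N <#>\<^bsub>fobj ?P N\<^esub> nat_kernel ?P F p N = carrier (fobj ?P N)" if N: "N \<in> C" for N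
    proof -
      interpret PN: comm_group "fobj ?P N" using additive_functor_comm_group[OF P N] .
      interpret FN: comm_group "fobj F N" using additive_functor_comm_group[OF F N] .
      interpret p: group_hom "fobj ?P N" "fobj F N" "p N"
        using p_hom[OF N] by unfold_locales
      have "?L N \<subseteq> carrier (fobj ?P N)"
        using subfunctor_subset[OF L N] .
      moreover have "h \<in> ?L N <#>\<^bsub>fobj ?P N\<^esub> nat_kernel ?P F p N" if h: "h \<in> carrier (fobj ?P N)" for h
      proof -
        let ?l = "compose (carrier X) h e"
        have l: "?l \<in> carrier (fobj ?P N)" "?l \<in> ?L N"
          using h e mod_hom_compose[OF C[OF X]] by (auto simp: carr generated_subfunctor_def mapP)
        \<comment> \<open>Naturality and Yoneda send \<open>?l\<close> to F(h)(F(e)(x)), which is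
          F(h)(x) because \<open>e\<close> fixes \<open>x\<close>. Thus \<open>h\<close> and
          \<open>?l\<close> differ by an element of the kernel.\<close>
        have "p N ?l = p N h"
          using h e nat[OF X N _ e(1)] yoneda X N by (simp add: carr)
        then have "inv\<^bsub>fobj ?P N\<^esub> ?l \<otimes>\<^bsub>fobj ?P N\<^esub> h \<in> nat_kernel ?P F p N"
          using h l by (simp add: nat_kernel_def kernel_def)
        moreover have "h = ?l \<otimes>\<^bsub>fobj ?P N\<^esub> (inv\<^bsub>fobj ?P N\<^esub> ?l \<otimes>\<^bsub>fobj ?P N\<^esub> h)"
          using h l by (simp flip: PN.m_assoc)
        ultimately show ?thesis using l unfolding set_mult_def by blast
      qed
      ultimately show ?thesis by (auto simp: set_mult_def nat_kernel_def kernel_def)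
    qed
    then have "?L X = carrier (fobj ?P X)" using sup L X unfolding superfluous_def by blast
    \<comment> \<open>Membership of the identity in the subfunctor generated by \<open>e\<close>
      says precisely that \<open>e\<close> has a left inverse.\<close>
    then have "mod_id X \<in> ?L X" using id by (simp add: carr)
    then show ?thesis by (auto simp: generated_subfunctor_def mapP)
  qed
qed

theorem lemma1p1:
  fixes R :: "'r ring" and M X Y :: "('r, 'u::infinite) module"
    and n :: nat and Ms :: "nat \<Rightarrow> ('r, 'u) module" and a :: "nat \<Rightarrow> nat"
    and C :: "('r, 'u) module set"
    and f :: "'u \<Rightarrow> 'u"
    and F :: "('r, 'u, 'g::infinite) modfunctor"
    and V :: "('u \<Rightarrow> 'u, 'v::ab_group_add) group_rep"
    and W :: "(('r, 'u) module \<Rightarrow> 'g \<Rightarrow> 'g, 'w::ab_group_add) group_rep"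
  assumes "ring R" and "finite (carrier R)"
    and "left_module R M" and "finite (carrier M)"
    and "\<And>i. i < n \<Longrightarrow> left_module R (Ms i) \<and> finite (carrier (Ms i)) \<and> indecomposable R (Ms i)"
    and "\<And>i j. \<lbrakk>i < n; j < n; i \<noteq> j\<rbrakk> \<Longrightarrow> \<not> mod_iso R (Ms i) (Ms j)"
    and "mod_iso R M (power_sum n Ms a)"
    and "C = sum_cat R n Ms"
    and "additive_functor R C F"
    and "minimal_presentation R C X f Y F"
    and "irreducible_rep (functor_aut_group R C F) W"
    and "irreducible_rep (aut_group R M) V"
    and "functor_morphing R C M V F W"
  shows "iso_to_summand R X M"
proof -
  have C: "left_module R N" if "N \<in> C" for N using that assms(8) by (simp add: sum_cat_def)
  \<comment> \<open>The multiplicities \<open>a\<close> witness that \<open>M\<close> is an object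
    of the category.\<close>
  have M: "M \<in> C" using assms(3,7,8) by (auto simp: sum_cat_def)
  have F: "additive_functor R C F" by fact
  obtain p where X: "X \<in> C" and p: "projective_cover R C (hom_functor R X) F p"
    using assms(10) by (auto simp: minimal_presentation_def)
  define x where "x = p X (mod_id X)"
  have x: "x \<in> carrier (fobj F X)" "generated_subfunctor R F X x M = carrier (fobj F M)"
    unfolding x_def using projective_cover_hom_functor_generator[OF C X p F] M by blast+
  have split: "\<exists>g\<in>mod_hom R X X. compose (carrier X) g e = mod_id X"
    if "e \<in> mod_hom R X X" "fmap F X X e x = x" for e
    using projective_cover_hom_functor_generator(3)[OF C X p F] that unfolding x_def by blast
  obtain v where v: "v \<in> carrier (fobj F M)"
    "\<And>N. N \<in> C \<Longrightarrow> generated_subfunctor R F M v N = carrier (fobj F N)"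
    using functor_morphing_generator[OF assms(13) _ C M] assms(12) by (auto simp: irreducible_rep_def)
  \<comment> \<open>Both \<open>x\<close> and \<open>v\<close> generate \<open>F\<close>, so each is
    carried to the other by some map.\<close>
  obtain h where h: "h \<in> mod_hom R X M" "v = fmap F X M h x"
    using v(1) x(2) by (auto simp: generated_subfunctor_def)
  obtain k where k: "k \<in> mod_hom R M X" "x = fmap F M X k v"
    using v(2)[OF X] x(1) by (auto simp: generated_subfunctor_def)
  have "fmap F X X (compose (carrier X) k h) x = fmap F M X k (fmap F X M h x)"
    using additive_functor_compose[OF F X M X h(1) k(1) x(1)] .
  then have "fmap F X X (compose (carrier X) k h) x = x" using h(2) k(2) by metis
  then obtain g where g: "g \<in> mod_hom R X X" "compose (carrier X) g (compose (carrier X) k h) = mod_id X"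
    using split mod_hom_compose[OF C[OF X] h(1) k(1)] by blast
  show ?thesis
  \<comment> \<open>Rebracketing the left inverse of \<open>k\<close> after \<open>h\<close> gives a
    retraction of \<open>h\<close>, namely \<open>g\<close> after \<open>k\<close>.\<close>
  proof (rule iso_to_summand_if_retract[OF C[OF X] C[OF M] h(1)])
    show "compose (carrier M) g k \<in> mod_hom R M X"
      using mod_hom_compose[OF C[OF M] k(1) g(1)] .
    show "compose (carrier M) g k (h y) = y" if "y \<in> carrier X" for y
      using fun_cong[OF g(2), of y] that mod_hom_closed[OF h(1) that]
      by (simp add: compose_def mod_id_def)
  qed
qed

end
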